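(* Let $\mathcal{H}$ be a complex Hilbert space. For $T\in\mathcal{B}(\mathcal{H})$ and $q\in[0,1]$ we have $$\omega_q^2(T)\le \frac{q^2}{4}\left(\|T\|+\|T^2\|^{\frac12}\right)^2+\left(1-q^2+q\sqrt{1-q^2}\right)\|T\|^2 .$$
   Context: $\mathcal{B}(\mathcal{H})$ denotes the bounded linear operators on the complex Hilbert space $\mathcal{H}$ and $\|\cdot\|$ the operator norm. For $q\in[0,1]$, the $q$-numerical radius of $T$ is $\omega_q(T)=\sup\{|\langle Tx,y\rangle| : x,y\in\mathcal{H},\ \|x\|=\|y\|=1,\ \langle x,y\rangle=q\}$, and $\omega_q^2(T)=(\omega_q(T))^2$. The supremum over the empty set (which occurs only when $\dim\mathcal{H}=0$, or $\dim\mathcal{H}=1$ and $q<1$) is read as $0$. *)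

theory Defs
  imports "HOL-Analysis.Analysis"
begin

text \<open>
  Building on the class \<open>real_normed_vector\<close> makes the library notions \<open>bounded_linear\<close> and
  \<open>onorm\<close> available. The norm axioms it contributes hold in every complex inner product space,
  so no space is excluded.
\<close>

class complex_vector = real_vector +
  fixes scaleC :: "complex \<Rightarrow> 'a \<Rightarrow> 'a"  (infixr \<open>*\<^sub>C\<close> 75)
  assumes scaleC_add_right: "a *\<^sub>C (x + y) = a *\<^sub>C x + a *\<^sub>C y"
    and scaleC_add_left: "(a + b) *\<^sub>C x = a *\<^sub>C x + b *\<^sub>C x"
    and scaleC_scaleC: "a *\<^sub>C (b *\<^sub>C x) = (a * b) *\<^sub>C x"
    and scaleC_of_real: "complex_of_real r *\<^sub>C x = r *\<^sub>R x"

text \<open>The inner product is linear in the first argument.\<close>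

class complex_inner = complex_vector + real_normed_vector +
  fixes cinner :: "'a \<Rightarrow> 'a \<Rightarrow> complex"
  assumes cinner_commute: "cinner x y = cnj (cinner y x)"
    and cinner_add_left: "cinner (x + y) z = cinner x z + cinner y z"
    and cinner_scaleC_left: "cinner (a *\<^sub>C x) y = a * cinner x y"
    and cinner_self_nonneg: "0 \<le> Re (cinner x x)"
    and cinner_self_eq_zero_iff: "cinner x x = 0 \<longleftrightarrow> x = 0"
    and norm_eq_sqrt_cinner: "norm x = sqrt (Re (cinner x x))"

class complex_hilbert = complex_inner + complete_space

instantiation complex :: complex_hilbert
begin

definition scaleC_complex :: "complex \<Rightarrow> complex \<Rightarrow> complex"
  where "scaleC_complex a x = a * x"

definition cinner_complex :: "complex \<Rightarrow> complex \<Rightarrow> complex"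
  where "cinner_complex x y = x * cnj y"

instance
proof
  fix x :: complex
  show "norm x = sqrt (Re (cinner x x))"
    by (simp add: cinner_complex_def cmod_def power2_eq_square)
qed (auto simp: scaleC_complex_def cinner_complex_def algebra_simps scaleR_conv_of_real)

end

locale bounded_clinear = bounded_linear T
  for T :: "'a::complex_inner \<Rightarrow> 'b::complex_inner" +
  assumes scaleC: "T (c *\<^sub>C x) = c *\<^sub>C T x"

definition q_numerical_values :: "real \<Rightarrow> ('a::complex_inner \<Rightarrow> 'a) \<Rightarrow> real set"
  where "q_numerical_values q T =
    {cmod (cinner (T x) y) | x y. norm x = 1 \<and> norm y = 1 \<and> cinner x y = complex_of_real q}"

text \<open>\<open>Sup {}\<close> is unspecified on the reals, so the supremum over the empty set is set to 0 explicitly.\<close>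

definition q_numerical_radius :: "real \<Rightarrow> ('a::complex_inner \<Rightarrow> 'a) \<Rightarrow> real"
  where "q_numerical_radius q T =
    (if q_numerical_values q T = {} then 0 else Sup (q_numerical_values q T))"

end

theory Submission
  imports Defs
begin

text \<open>
  Let \<open>\<parallel>x\<parallel> = \<parallel>y\<parallel> = 1\<close> and \<open>\<langle>x, y\<rangle> = q\<close>, and put \<open>a = \<langle>T x, x\<rangle>\<close>. Splitting off the components along
  \<open>x\<close> gives \<open>\<langle>T x, y\<rangle> = q a + \<langle>T x - a x, y - q x\<rangle>\<close>, where \<open>\<parallel>y - q x\<parallel>\<^sup>2 = 1 - q\<^sup>2\<close> and
  \<open>\<parallel>T x - a x\<parallel>\<^sup>2 = \<parallel>T x\<parallel>\<^sup>2 - \<bar>a\<bar>\<^sup>2\<close>. Expanding the square and estimating the mixed term by the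
  inequality between the arithmetic and the geometric mean leaves \<open>q\<^sup>2 \<bar>a\<bar>\<^sup>2\<close> plus the
  multiple of \<open>\<parallel>T\<parallel>\<^sup>2\<close> in the claim. So everything rests on Kittaneh's bound
  \<open>\<bar>\<langle>T x, x\<rangle>\<bar> \<le> (\<parallel>T\<parallel> + \<parallel>T\<^sup>2\<parallel>\<^sup>1\<^sup>/\<^sup>2) / 2\<close> (\<open>cmod_quadratic_form_le\<close>).

  Here is why that bound holds. After multiplying \<open>T\<close> by a phase it suffices to bound
  \<open>\<nu> = sup Re \<langle>T x, x\<rangle>\<close>. Suppose first that the supremum is attained at \<open>x\<close>. Then \<open>x\<close> is an eigenvector
  of \<open>T + T\<^sup>*\<close> with eigenvalue \<open>\<mu> = 2 \<nu>\<close>, that is, \<open>T\<^sup>* x = \<mu> x - T x\<close>. Applying \<open>T\<close> and \<open>T\<^sup>*\<close> to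
  \<open>\<mu> x = T x + T\<^sup>* x\<close> yields \<open>\<mu> \<parallel>T x\<parallel> \<le> \<parallel>T\<^sup>2\<parallel> + \<parallel>T\<parallel> \<parallel>T\<^sup>* x\<parallel>\<close> and
  \<open>\<mu> \<parallel>T\<^sup>* x\<parallel> \<le> \<parallel>T\<^sup>2\<parallel> + \<parallel>T\<parallel> \<parallel>T x\<parallel>\<close>. Adding these and using \<open>\<mu> \<le> \<parallel>T x\<parallel> + \<parallel>T\<^sup>* x\<parallel>\<close>
  gives \<open>\<mu> (\<mu> - \<parallel>T\<parallel>) \<le> 2 \<parallel>T\<^sup>2\<parallel>\<close> when \<open>\<mu> \<ge> \<parallel>T\<parallel>\<close>, which forces \<open>\<mu> \<le> \<parallel>T\<parallel> + \<parallel>T\<^sup>2\<parallel>\<^sup>1\<^sup>/\<^sup>2\<close> because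
  \<open>\<parallel>T\<^sup>2\<parallel> \<le> \<parallel>T\<parallel>\<^sup>2\<close>.

  In general a unit vector that comes close to the supremum is an approximate eigenvector in the weak sense of
  \<open>near_maximizer_approx_eigenvector\<close>: the vector \<open>\<mu> x - T x\<close> plays the part of \<open>T\<^sup>* x\<close> up to a small
  error, so that the argument goes through without constructing the adjoint.
\<close>

section \<open>Inner product identities and the Cauchy--Schwarz inequality\<close>

lemma cinner_add_right: "cinner x (y + z) = cinner x y + cinner x (z::'a::complex_inner)"
  by (metis cinner_add_left cinner_commute complex_cnj_add)

lemma cinner_scaleC_right: "cinner x (c *\<^sub>C y) = cnj c * cinner x (y::'a::complex_inner)"
  by (metis cinner_commute cinner_scaleC_left complex_cnj_mult)

lemma cinner_scaleR_left: "cinner (r *\<^sub>R x) y = r * cinner x (y::'a::complex_inner)"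
  by (metis cinner_scaleC_left scaleC_of_real)

lemma cinner_scaleR_right: "cinner x (r *\<^sub>R y) = r * cinner x (y::'a::complex_inner)"
  by (metis cinner_scaleC_right scaleC_of_real complex_cnj_complex_of_real)

lemma cinner_diff_left: "cinner (x - y) z = cinner x z - cinner y (z::'a::complex_inner)"
  using cinner_add_left[of "x - y" y z] by simp

lemma cinner_diff_right: "cinner x (y - z) = cinner x y - cinner x (z::'a::complex_inner)"
  using cinner_add_right[of x "y - z" z] by simp

lemma cinner_self: "cinner x x = complex_of_real ((norm (x::'a::complex_inner))\<^sup>2)"
proof -
  have "Im (cinner x x) = 0"
    using arg_cong[OF cinner_commute[of x x], of Im] by simp
  then show ?thesis
    by (simp add: complex_eq_iff norm_eq_sqrt_cinner cinner_self_nonneg)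
qed

lemma Re_cinner_self: "Re (cinner x x) = (norm (x::'a::complex_inner))\<^sup>2"
  by (simp add: cinner_self)

lemma Re_cinner_commute: "Re (cinner x y) = Re (cinner y (x::'a::complex_inner))"
  by (subst cinner_commute) simp

lemma Re_cinner_le_norm: "Re (cinner x y) \<le> norm x * norm (y::'a::complex_inner)"
proof -
  have "(norm (x + y))\<^sup>2 \<le> (norm x + norm y)\<^sup>2"
    by (intro power_mono norm_triangle_ineq) auto
  moreover have "(norm (x + y))\<^sup>2 = (norm x)\<^sup>2 + 2 * Re (cinner x y) + (norm y)\<^sup>2"
    using Re_cinner_commute[of x y]
    by (simp flip: Re_cinner_self add: cinner_add_left cinner_add_right)
  ultimately show ?thesis
    by (simp add: power2_sum)
qed

lemma norm_scaleC: "norm (c *\<^sub>C x) = cmod c * norm (x::'a::complex_inner)"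
proof -
  have "cinner (c *\<^sub>C x) (c *\<^sub>C x) = (c * cnj c) * cinner x x"
    by (simp add: cinner_scaleC_left cinner_scaleC_right)
  also have "\<dots> = complex_of_real ((cmod c * norm x)\<^sup>2)"
    by (simp add: complex_norm_square[symmetric] cinner_self power_mult_distrib)
  finally have "(norm (c *\<^sub>C x))\<^sup>2 = (cmod c * norm x)\<^sup>2"
    by (metis Re_cinner_self Re_complex_of_real)
  then show ?thesis
    by simp
qed

lemma exists_phase:
  obtains c where "cmod c = 1" "Re (c * z) = cmod z"
proof (cases "z = 0")
  case True
  then show ?thesis using that[of 1] by simp
next
  case False
  have "cnj z / cmod z * z = cmod z"
    using False complex_norm_square[of z] by (simp add: field_simps power2_eq_square)
  then have "Re (cnj z / cmod z * z) = cmod z"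
    by (metis Re_complex_of_real)
  moreover have "cmod (cnj z / cmod z) = 1"
    using False by (simp add: norm_divide)
  ultimately show ?thesis
    using that by blast
qed

lemma cmod_cinner_le_norm: "cmod (cinner x y) \<le> norm x * norm (y::'a::complex_inner)"
proof -
  obtain c where c: "cmod c = 1" "Re (c * cinner x y) = cmod (cinner x y)"
    by (rule exists_phase)
  then show ?thesis
    using Re_cinner_le_norm[of "c *\<^sub>C x" y] by (simp add: cinner_scaleC_left norm_scaleC)
qed

section \<open>The numerical radius\<close>

lemma nonneg_quadratic_discriminant:
  fixes a b c :: real
  assumes nonneg: "\<And>t. 0 \<le> a + 2 * t * b + t\<^sup>2 * c" and "0 \<le> a" "0 \<le> c"
  shows "\<bar>b\<bar> \<le> sqrt (a * c)"
proof -
  have "b\<^sup>2 \<le> a * c"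
  proof (cases "c = 0")
    case True
    have "b = 0"
    proof (rule ccontr)
      assume "b \<noteq> 0"
      then show False
        using nonneg[of "- (a + 1) / (2 * b)"] \<open>0 \<le> a\<close> True by (simp add: field_simps)
    qed
    then show ?thesis using True by simp
  next
    case False
    then have "0 < c" using \<open>0 \<le> c\<close> by simp
    then have "0 \<le> c * (a + 2 * (- b / c) * b + (- b / c)\<^sup>2 * c)"
      by (intro mult_nonneg_nonneg nonneg) simp
    also have "\<dots> = a * c - b\<^sup>2"
      using \<open>0 < c\<close> by (simp add: field_simps power2_eq_square)
    finally show ?thesis by simp
  qed
  then show ?thesis
    using real_le_rsqrt[of "\<bar>b\<bar>"] by simp
qed

text \<open>
  Near the maximum of its quadratic form, the operator \<open>T + T\<^sup>*\<close> almost acts as multiplication by \<open>2 \<nu>\<close>: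
  this is the Cauchy--Schwarz inequality for the positive semidefinite form of \<open>2 \<nu> - T - T\<^sup>*\<close>, whose value at
  \<open>x\<close> is at most \<open>2 \<epsilon>\<close>.
\<close>

lemma near_maximizer_approx_eigenvector:
  fixes T :: "'a::complex_inner \<Rightarrow> 'a"
  assumes T: "bounded_linear T"
    and max: "\<And>v. Re (cinner (T v) v) \<le> \<nu> * (norm v)\<^sup>2"
    and x: "norm x = 1" "\<nu> - \<epsilon> \<le> Re (cinner (T x) x)"
  shows "\<bar>2 * \<nu> * Re (cinner x v) - Re (cinner (T x) v) - Re (cinner x (T v))\<bar>
    \<le> 2 * sqrt (\<epsilon> * (\<nu> + onorm T)) * norm v"
proof -
  interpret bounded_linear T by (rule T)
  define B where "B u v = 2 * \<nu> * Re (cinner u v) - Re (cinner (T u) v) - Re (cinner u (T v))" for u v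
  have diag: "B u u = 2 * (\<nu> * (norm u)\<^sup>2 - Re (cinner (T u) u))" for u
    unfolding B_def using Re_cinner_commute[of u "T u"] by (simp add: Re_cinner_self)
  have nonneg: "0 \<le> B u u" for u
    using max[of u] by (simp add: diag)
  have sym: "B v x = B x v"
    unfolding B_def using Re_cinner_commute[of x v] Re_cinner_commute[of x "T v"]
      Re_cinner_commute[of v "T x"] by simp
  have "B (x + t *\<^sub>R v) (x + t *\<^sub>R v) = B x x + t * (B x v + B v x) + t\<^sup>2 * B v v" for t
    unfolding B_def
    by (simp add: add scaleR cinner_add_left cinner_add_right cinner_scaleR_left cinner_scaleR_right
        algebra_simps power2_eq_square)
  then have "0 \<le> B x x + 2 * t * B x v + t\<^sup>2 * B v v" for t
    using nonneg[of "x + t *\<^sub>R v"] sym by simp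
  then have "\<bar>B x v\<bar> \<le> sqrt (B x x * B v v)"
    by (intro nonneg_quadratic_discriminant nonneg)
  also have "\<dots> \<le> sqrt ((2 * \<epsilon>) * (2 * (\<nu> + onorm T) * (norm v)\<^sup>2))"
  proof (intro real_sqrt_le_mono mult_mono nonneg)
    show "B x x \<le> 2 * \<epsilon>"
      using x by (simp add: diag)
    then show "0 \<le> 2 * \<epsilon>"
      using nonneg[of x] by simp
    have "- Re (cinner (T v) v) \<le> norm (T v) * norm v"
      using abs_Re_le_cmod[of "cinner (T v) v"] cmod_cinner_le_norm[of "T v" v] by linarith
    also have "\<dots> \<le> onorm T * norm v * norm v"
      by (intro mult_right_mono onorm T) auto
    finally show "B v v \<le> 2 * (\<nu> + onorm T) * (norm v)\<^sup>2"
      by (simp add: diag algebra_simps power2_eq_square)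
  qed
  also have "(2 * \<epsilon>) * (2 * (\<nu> + onorm T) * (norm v)\<^sup>2) = (2 * norm v)\<^sup>2 * (\<epsilon> * (\<nu> + onorm T))"
    by (simp add: power2_eq_square)
  also have "sqrt \<dots> = 2 * sqrt (\<epsilon> * (\<nu> + onorm T)) * norm v"
    by (simp add: real_sqrt_mult)
  finally show ?thesis
    unfolding B_def .
qed

text \<open>
  In the proof, \<open>w\<close> stands in for \<open>T\<^sup>* x\<close>. The estimate of \<open>\<parallel>T x\<parallel>\<close> is exact, while that of \<open>\<parallel>w\<parallel>\<close> replaces
  \<open>T\<^sup>* x\<close> by \<open>w\<close> twice and so carries an error proportional to \<open>\<delta>\<close>.
\<close>

lemma approx_eigenvalue_bound:
  fixes T :: "'a::complex_inner \<Rightarrow> 'a"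
  assumes T: "bounded_linear T" and x: "norm x = 1" and \<mu>: "onorm T \<le> \<mu>"
    and approx: "\<And>v. \<bar>\<mu> * Re (cinner x v) - Re (cinner (T x) v) - Re (cinner x (T v))\<bar> \<le> \<delta> * norm v"
  shows "\<mu> * (\<mu> - onorm T) \<le> 2 * onorm (T \<circ> T) + \<delta> * (\<mu> + onorm T)"
proof -
  interpret bounded_linear T by (rule T)
  define a where "a = onorm T"
  define b where "b = onorm (T \<circ> T)"
  define w where "w = \<mu> *\<^sub>R x - T x"
  have a: "norm (T v) \<le> a * norm v" for v
    unfolding a_def by (rule onorm[OF T])
  have b: "norm (T (T v)) \<le> b * norm v" for v
    unfolding b_def using onorm[of "T \<circ> T" v] bounded_linear_compose[OF T T] by (simp add: o_def)
  have "0 \<le> a"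
    unfolding a_def by (rule onorm_pos_le[OF T])
  have "0 \<le> \<mu>"
    using \<mu> \<open>0 \<le> a\<close> a_def by simp
  have "0 \<le> \<delta>"
    using order_trans[OF abs_ge_zero approx[of x]] x by simp
  have w: "\<bar>Re (cinner w v) - Re (cinner x (T v))\<bar> \<le> \<delta> * norm v" for v
    using approx[of v] by (simp add: w_def cinner_diff_left cinner_scaleR_left)

  have "\<mu> *\<^sub>R T x = T w + T (T x)"
    by (simp add: w_def diff scaleR)
  then have "\<mu> * norm (T x) \<le> norm (T w) + norm (T (T x))"
    using norm_triangle_ineq[of "T w" "T (T x)"] \<open>0 \<le> \<mu>\<close> by (metis norm_scaleR abs_of_nonneg)
  then have Tx: "\<mu> * norm (T x) \<le> a * norm w + b"
    using a[of w] b[of x] x by simp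

  have "\<mu> * norm w \<le> a * norm (T x) + b + \<delta> * (\<mu> + a)"
  proof (cases "w = 0")
    case True
    have "0 \<le> b"
      using order_trans[OF norm_ge_zero b[of x]] x by simp
    then show ?thesis
      using True \<open>0 \<le> a\<close> \<open>0 \<le> \<mu>\<close> \<open>0 \<le> \<delta>\<close> by simp
  next
    case False
    have "Re (cinner w w) \<le> Re (cinner x (T w)) + \<delta> * norm w"
      using w[of w] by simp
    then have "\<mu> * (norm w)\<^sup>2 \<le> \<mu> * (Re (cinner x (T w)) + \<delta> * norm w)"
      using \<open>0 \<le> \<mu>\<close> by (simp add: Re_cinner_self mult_left_mono)
    also have "\<mu> * Re (cinner x (T w)) = Re (cinner w (T w)) + Re (cinner (T x) (T w))"
      by (simp add: w_def cinner_diff_left cinner_scaleR_left)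
    then have "\<mu> * (Re (cinner x (T w)) + \<delta> * norm w)
        = Re (cinner w (T w)) + Re (cinner (T x) (T w)) + \<mu> * \<delta> * norm w"
      by (simp add: algebra_simps)
    also have "\<dots> \<le> (b + \<delta> * a) * norm w + norm (T x) * (a * norm w) + \<mu> * \<delta> * norm w"
    proof (intro add_mono order_refl)
      have "Re (cinner x (T (T w))) \<le> norm (T (T w))"
        using Re_cinner_le_norm[of x "T (T w)"] x by simp
      then have "Re (cinner w (T w)) \<le> b * norm w + \<delta> * norm (T w)"
        using w[of "T w"] b[of w] by linarith
      also have "\<dots> \<le> b * norm w + \<delta> * (a * norm w)"
        by (intro add_left_mono mult_left_mono a \<open>0 \<le> \<delta>\<close>)
      finally show "Re (cinner w (T w)) \<le> (b + \<delta> * a) * norm w"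
        by (simp add: algebra_simps)
      have "Re (cinner (T x) (T w)) \<le> norm (T x) * norm (T w)"
        by (rule Re_cinner_le_norm)
      also have "\<dots> \<le> norm (T x) * (a * norm w)"
        by (intro mult_left_mono a) simp
      finally show "Re (cinner (T x) (T w)) \<le> norm (T x) * (a * norm w)" .
    qed
    finally have "\<mu> * norm w * norm w \<le> (a * norm (T x) + b + \<delta> * (\<mu> + a)) * norm w"
      by (simp add: algebra_simps power2_eq_square)
    then show ?thesis
      using False by (simp add: mult_le_cancel_right)
  qed
  with Tx have sum: "(\<mu> - a) * (norm (T x) + norm w) \<le> 2 * b + \<delta> * (\<mu> + a)"
    by (simp add: algebra_simps)
  have "\<mu> = norm (T x + w)"
    using x \<open>0 \<le> \<mu>\<close> by (simp add: w_def)
  also have "\<dots> \<le> norm (T x) + norm w"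
    by (rule norm_triangle_ineq)
  finally have "(\<mu> - a) * \<mu> \<le> (\<mu> - a) * (norm (T x) + norm w)"
    using \<mu> a_def by (intro mult_left_mono) auto
  with sum show ?thesis
    by (simp add: a_def b_def mult.commute)
qed

text \<open>
  If the supremum \<open>\<nu>\<close> of \<open>Re \<langle>T v, v\<rangle>\<close> over unit vectors were larger than the bound, then
  \<open>2 \<nu> (2 \<nu> - \<parallel>T\<parallel>)\<close> would exceed \<open>2 \<parallel>T\<^sup>2\<parallel>\<close> by a fixed amount, which the approximate eigenvalue
  bound at a vector close enough to the supremum rules out.
\<close>

lemma Re_quadratic_form_le:
  fixes T :: "'a::complex_inner \<Rightarrow> 'a"
  assumes T: "bounded_linear T" and x: "norm x = 1"
  shows "Re (cinner (T x) x) \<le> (onorm T + sqrt (onorm (T \<circ> T))) / 2"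
proof -
  interpret bounded_linear T by (rule T)
  define a where "a = onorm T"
  define b where "b = onorm (T \<circ> T)"
  define S where "S = (\<lambda>v. Re (cinner (T v) v)) ` {v. norm v = 1}"
  define \<nu> where "\<nu> = Sup S"
  have "0 \<le> a"
    unfolding a_def by (rule onorm_pos_le[OF T])
  have "0 \<le> b"
    unfolding b_def using onorm_pos_le[of "T \<circ> T"] bounded_linear_compose[OF T T] by (simp add: o_def)
  have "b \<le> a * a"
    unfolding a_def b_def by (rule onorm_compose[OF T T])
  then have "sqrt b \<le> a"
    using \<open>0 \<le> a\<close> by (simp add: real_le_lsqrt power2_eq_square)
  have "S \<noteq> {}"
    using x S_def by blast
  have "Re (cinner (T v) v) \<le> a" if "norm v = 1" for v
    using Re_cinner_le_norm[of "T v" v] onorm[OF T, of v] that by (simp add: a_def)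
  then have "bdd_above S"
    unfolding S_def by (intro bdd_aboveI[of _ a]) auto
  have unit: "Re (cinner (T v) v) \<le> \<nu>" if "norm v = 1" for v
    unfolding \<nu>_def using \<open>bdd_above S\<close> that by (intro cSup_upper) (auto simp: S_def)
  have max: "Re (cinner (T v) v) \<le> \<nu> * (norm v)\<^sup>2" for v
  proof (cases "v = 0")
    case True
    then show ?thesis
      using Re_cinner_le_norm[of "T v" v] by simp
  next
    case False
    define u where "u = (1 / norm v) *\<^sub>R v"
    have "norm u = 1" "v = norm v *\<^sub>R u"
      using False by (auto simp: u_def)
    moreover have "Re (cinner (T (r *\<^sub>R u)) (r *\<^sub>R u)) = r\<^sup>2 * Re (cinner (T u) u)" for r
      by (simp add: scaleR cinner_scaleR_left cinner_scaleR_right power2_eq_square)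
    ultimately have "Re (cinner (T v) v) = (norm v)\<^sup>2 * Re (cinner (T u) u)"
      by metis
    then show ?thesis
      using unit[OF \<open>norm u = 1\<close>] by (simp add: mult.commute mult_right_mono)
  qed
  have "\<nu> \<le> (a + sqrt b) / 2"
  proof (rule ccontr)
    assume "\<not> \<nu> \<le> (a + sqrt b) / 2"
    then have large: "a + sqrt b < 2 * \<nu>"
      by simp
    then have "0 < \<nu>" "a \<le> 2 * \<nu>"
      using \<open>0 \<le> a\<close> \<open>0 \<le> b\<close> real_sqrt_ge_zero[of b] by linarith+
    have "2 * b \<le> (a + sqrt b) * sqrt b"
      using mult_right_mono[OF \<open>sqrt b \<le> a\<close>, of "sqrt b"] \<open>0 \<le> b\<close> by (simp add: algebra_simps)
    also have "\<dots> < 2 * \<nu> * (2 * \<nu> - a)"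
      using large \<open>0 \<le> a\<close> \<open>0 \<le> b\<close> by (intro mult_strict_mono') auto
    finally have gap: "2 * b < 2 * \<nu> * (2 * \<nu> - a)" .
    \<comment> \<open>The error term \<open>\<delta> (2 \<nu> + a)\<close> is half of the gap \<open>g\<close>, and \<open>\<epsilon>\<close> is chosen to produce this \<open>\<delta>\<close>.\<close>
    define g where "g = 2 * \<nu> * (2 * \<nu> - a) - 2 * b"
    define \<delta> where "\<delta> = g / (2 * (2 * \<nu> + a))"
    have "0 < g"
      using gap by (simp only: g_def diff_gt_0_iff_gt)
    define \<epsilon> where "\<epsilon> = (\<delta> / 2)\<^sup>2 / (\<nu> + a)"
    have "0 < \<delta>"
      using \<open>0 < g\<close> \<open>0 < \<nu>\<close> \<open>0 \<le> a\<close> by (simp add: \<delta>_def)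
    then have "0 < \<epsilon>"
      using \<open>0 < \<nu>\<close> \<open>0 \<le> a\<close> by (simp add: \<epsilon>_def)
    have "\<epsilon> * (\<nu> + a) = (\<delta> / 2)\<^sup>2"
      using \<open>0 < \<nu>\<close> \<open>0 \<le> a\<close> by (simp add: \<epsilon>_def)
    then have \<delta>: "2 * sqrt (\<epsilon> * (\<nu> + onorm T)) = \<delta>"
      using \<open>0 < \<delta>\<close> by (simp add: a_def)
    obtain z where z: "norm z = 1" "\<nu> - \<epsilon> < Re (cinner (T z) z)"
      using less_cSupE[of "\<nu> - \<epsilon>" S] \<open>0 < \<epsilon>\<close> \<open>S \<noteq> {}\<close> by (auto simp: \<nu>_def S_def)
    have "\<bar>2 * \<nu> * Re (cinner z v) - Re (cinner (T z) v) - Re (cinner z (T v))\<bar> \<le> \<delta> * norm v" for v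
      using near_maximizer_approx_eigenvector[OF T max z(1), of \<epsilon> v] z(2) by (simp only: \<delta> less_imp_le)
    then have "2 * \<nu> * (2 * \<nu> - a) \<le> 2 * b + \<delta> * (2 * \<nu> + a)"
      using approx_eigenvalue_bound[OF T z(1), of "2 * \<nu>" \<delta>] \<open>a \<le> 2 * \<nu>\<close> by (simp add: a_def b_def)
    then have "g \<le> \<delta> * (2 * \<nu> + a)"
      unfolding g_def diff_le_eq by (simp only: add.commute)
    moreover have "2 * \<nu> + a \<noteq> 0"
      using \<open>0 < \<nu>\<close> \<open>0 \<le> a\<close> by simp
    then have "\<delta> * (2 * \<nu> + a) = g / 2"
      unfolding \<delta>_def times_divide_eq_left by (rule mult_divide_mult_cancel_right)
    ultimately show False
      using \<open>0 < g\<close> by linarith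
  qed
  then show ?thesis
    using unit[OF x] by (simp add: a_def b_def)
qed

text \<open>
  Kittaneh's inequality. Complex linearity enters through \<open>(c T)\<^sup>2 = c\<^sup>2 T\<^sup>2\<close>: rotating \<open>T\<close> by a phase
  \<open>c\<close> makes \<open>\<langle>T x, x\<rangle>\<close> real and nonnegative without changing either norm.
\<close>

lemma cmod_quadratic_form_le:
  fixes T :: "'a::complex_inner \<Rightarrow> 'a"
  assumes T: "bounded_clinear T" and x: "norm x = 1"
  shows "cmod (cinner (T x) x) \<le> (onorm T + sqrt (onorm (T \<circ> T))) / 2"
proof -
  interpret bounded_clinear T by (rule T)
  obtain c where c: "cmod c = 1" "Re (c * cinner (T x) x) = cmod (cinner (T x) x)"
    by (rule exists_phase)
  define U where "U v = c *\<^sub>C T v" for v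
  have norm_U: "norm (U v) = norm (T v)" for v
    by (simp add: U_def norm_scaleC c)
  have "bounded_linear U"
  proof (rule bounded_linear_intro)
    show "U (v + w) = U v + U w" for v w
      by (simp add: U_def add scaleC_add_right)
    show "U (r *\<^sub>R v) = r *\<^sub>R U v" for r v
      by (simp add: U_def scaleR) (metis mult.commute scaleC_of_real scaleC_scaleC)
    show "norm (U v) \<le> norm v * onorm T" for v
      using onorm[OF bounded_linear_axioms, of v] by (simp add: norm_U mult.commute)
  qed
  moreover have "onorm U = onorm T"
    by (simp add: onorm_def norm_U)
  moreover have "norm (U (U v)) = norm (T (T v))" for v
    by (simp add: norm_U) (simp add: U_def scaleC norm_scaleC c)
  then have "onorm (U \<circ> U) = onorm (T \<circ> T)"
    by (simp add: onorm_def)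
  ultimately show ?thesis
    using Re_quadratic_form_le[of U x] x c(2) by (simp add: U_def cinner_scaleC_left)
qed

section \<open>The bound on the \<open>q\<close>-numerical radius\<close>

text \<open>
  The orthogonal complement of \<open>x\<close> contributes only through the components of \<open>u\<close> and \<open>y\<close> in it, whose
  norms Pythagoras' theorem computes. Leaving the component of \<open>y\<close> unnormalised covers the case \<open>q = 1\<close>,
  where it vanishes.
\<close>

lemma cmod_cinner_le_of_components:
  fixes x y u :: "'a::complex_inner"
  assumes x: "norm x = 1" and y: "norm y = 1" and xy: "cinner x y = complex_of_real q" and "0 \<le> q"
  shows "cmod (cinner u y)
    \<le> q * cmod (cinner u x) + sqrt (1 - q\<^sup>2) * sqrt ((norm u)\<^sup>2 - (cmod (cinner u x))\<^sup>2)"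
proof -
  define a where "a = cinner u x"
  define u' where "u' = u - a *\<^sub>C x"
  define y' where "y' = y - complex_of_real q *\<^sub>C x"
  note expand = cinner_diff_left cinner_diff_right cinner_scaleC_left cinner_scaleC_right
  have yx: "cinner y x = complex_of_real q" and xu: "cinner x u = cnj a"
    using cinner_commute[of y x] cinner_commute[of x u] xy by (simp_all add: a_def)
  have xx: "cinner x x = 1"
    by (simp add: cinner_self x)
  have split: "cinner u y = q * a + cinner u' y'"
    by (simp add: u'_def y'_def expand xx xy flip: a_def)
  have "cinner u' u' = cinner u u - a * cnj a"
    by (simp add: u'_def expand xx xu flip: a_def)
  also have "\<dots> = complex_of_real ((norm u)\<^sup>2 - (cmod a)\<^sup>2)"
    by (simp add: cinner_self complex_norm_square[symmetric])
  finally have "(norm u')\<^sup>2 = (norm u)\<^sup>2 - (cmod a)\<^sup>2"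
    by (metis Re_cinner_self Re_complex_of_real)
  then have u': "norm u' = sqrt ((norm u)\<^sup>2 - (cmod a)\<^sup>2)"
    by (metis norm_ge_zero real_sqrt_unique)
  have "cinner y' y' = complex_of_real (1 - q\<^sup>2)"
    by (simp add: y'_def expand xx xy yx cinner_self[of y] y power2_eq_square)
  then have "(norm y')\<^sup>2 = 1 - q\<^sup>2"
    by (metis Re_cinner_self Re_complex_of_real)
  then have y': "norm y' = sqrt (1 - q\<^sup>2)"
    by (metis norm_ge_zero real_sqrt_unique)
  have "cmod (cinner u y) \<le> cmod (q * a) + cmod (cinner u' y')"
    unfolding split by (rule norm_triangle_ineq)
  also have "\<dots> \<le> q * cmod a + norm u' * norm y'"
    using cmod_cinner_le_norm[of u' y'] \<open>0 \<le> q\<close> by (simp add: norm_mult)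
  finally show ?thesis
    by (simp add: u' y' a_def mult.commute)
qed

lemma q_numerical_value_squared_le:
  fixes T :: "'a::complex_inner \<Rightarrow> 'a"
  assumes T: "bounded_clinear T" and q: "0 \<le> q" "q \<le> 1"
    and x: "norm x = 1" and y: "norm y = 1" and xy: "cinner x y = complex_of_real q"
  shows "(cmod (cinner (T x) y))\<^sup>2
    \<le> q\<^sup>2 / 4 * (onorm T + sqrt (onorm (T \<circ> T)))\<^sup>2
      + (1 - q\<^sup>2 + q * sqrt (1 - q\<^sup>2)) * (onorm T)\<^sup>2"
proof -
  interpret bounded_clinear T by (rule T)
  define \<alpha> where "\<alpha> = cmod (cinner (T x) x)"
  define \<beta> where "\<beta> = sqrt ((norm (T x))\<^sup>2 - \<alpha>\<^sup>2)"
  define s where "s = sqrt (1 - q\<^sup>2)"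
  define N where "N = onorm T"
  have "q\<^sup>2 \<le> 1"
    using q by (simp add: power_le_one)
  then have s: "0 \<le> s" "s\<^sup>2 = 1 - q\<^sup>2"
    by (simp_all add: s_def)
  have "\<alpha> \<le> norm (T x)"
    using cmod_cinner_le_norm[of "T x" x] x by (simp add: \<alpha>_def)
  then have "\<alpha>\<^sup>2 \<le> (norm (T x))\<^sup>2"
    by (intro power_mono) (simp_all add: \<alpha>_def)
  then have "\<alpha>\<^sup>2 + \<beta>\<^sup>2 = (norm (T x))\<^sup>2"
    by (simp add: \<beta>_def)
  also have "\<dots> \<le> N\<^sup>2"
    using onorm[OF bounded_linear_axioms, of x] x by (intro power_mono) (simp_all add: N_def)
  finally have \<alpha>\<beta>: "\<alpha>\<^sup>2 + \<beta>\<^sup>2 \<le> N\<^sup>2" .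
  then have "\<beta>\<^sup>2 \<le> N\<^sup>2"
    using zero_le_power2[of \<alpha>] by linarith
  \<comment> \<open>This estimate of the mixed term is where \<open>q \<surd>(1 - q\<^sup>2) \<parallel>T\<parallel>\<^sup>2\<close> comes from.\<close>
  have "2 * (\<alpha> * \<beta>) \<le> N\<^sup>2"
    using \<alpha>\<beta> sum_squares_bound[of \<alpha> \<beta>] by simp
  have "\<alpha>\<^sup>2 \<le> ((N + sqrt (onorm (T \<circ> T))) / 2)\<^sup>2"
    using cmod_quadratic_form_le[OF T x] by (intro power_mono) (simp_all add: \<alpha>_def N_def)
  have "cmod (cinner (T x) y) \<le> q * \<alpha> + s * \<beta>"
    using cmod_cinner_le_of_components[OF x y xy q(1), of "T x"] by (simp add: \<alpha>_def \<beta>_def s_def)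
  then have "(cmod (cinner (T x) y))\<^sup>2 \<le> (q * \<alpha> + s * \<beta>)\<^sup>2"
    by (intro power_mono) simp_all
  also have "\<dots> = q\<^sup>2 * \<alpha>\<^sup>2 + (s\<^sup>2 * \<beta>\<^sup>2 + q * s * (2 * (\<alpha> * \<beta>)))"
    by (simp add: power2_eq_square algebra_simps)
  also have "\<dots> \<le> q\<^sup>2 * ((N + sqrt (onorm (T \<circ> T))) / 2)\<^sup>2 + (s\<^sup>2 * N\<^sup>2 + q * s * N\<^sup>2)"
    by (intro add_mono mult_left_mono) (fact | simp add: q s(1))+
  also have "\<dots> = q\<^sup>2 / 4 * (N + sqrt (onorm (T \<circ> T)))\<^sup>2 + (s\<^sup>2 + q * s) * N\<^sup>2"
    by (simp add: power_divide distrib_right)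
  also have "s\<^sup>2 + q * s = 1 - q\<^sup>2 + q * sqrt (1 - q\<^sup>2)"
    unfolding s(2) by (simp add: s_def)
  finally show ?thesis
    unfolding N_def .
qed

theorem corollary2p7:
  fixes T :: "'a::complex_hilbert \<Rightarrow> 'a" and q :: real
  assumes "bounded_clinear T"
    and "0 \<le> q" and "q \<le> 1"
  shows "(q_numerical_radius q T)\<^sup>2
    \<le> q\<^sup>2 / 4 * (onorm T + sqrt (onorm (T \<circ> T)))\<^sup>2
      + (1 - q\<^sup>2 + q * sqrt (1 - q\<^sup>2)) * (onorm T)\<^sup>2"
    (is "_ \<le> ?R")
proof (cases "q_numerical_values q T = {}")
  case True
  have "q\<^sup>2 \<le> 1"
    using assms by (simp add: power_le_one)
  then show ?thesis
    using True assms by (simp add: q_numerical_radius_def)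
next
  case False
  have bound: "0 \<le> r \<and> r \<le> sqrt ?R" if "r \<in> q_numerical_values q T" for r
    using that q_numerical_value_squared_le[OF assms]
    by (auto simp: q_numerical_values_def intro: real_le_rsqrt)
  obtain r where r: "r \<in> q_numerical_values q T"
    using False by blast
  have "bdd_above (q_numerical_values q T)"
    using bound by (intro bdd_aboveI[of _ "sqrt ?R"]) blast
  then have "0 \<le> Sup (q_numerical_values q T)"
    using cSup_upper[OF r] bound[OF r] by linarith
  moreover have "Sup (q_numerical_values q T) \<le> sqrt ?R"
    using False bound by (intro cSup_least) auto
  ultimately have "(Sup (q_numerical_values q T))\<^sup>2 \<le> (sqrt ?R)\<^sup>2"
    by (intro power_mono)
  moreover have "0 \<le> ?R"
    using bound[OF r] by (meson order_trans real_sqrt_ge_0_iff)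
  ultimately show ?thesis
    using False by (simp add: q_numerical_radius_def)
qed

end
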